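(* Let $A=\{a_{ij}\}_{i,j=0,1,2,\ldots}$ be a double sequence of complex constants that defines a regular method of summability, and let $h(z)=\sum_{j=0}^{\infty} h_j z^j$ be a complex power series. Then for any complex number $z$ for which the sequence $\{h_i z^i\}_{i\ge 0}$ is convergent, the following two conditions are equivalent: (i) $\lim_{j\to\infty} h_j z^j = 1$; (ii) the double sequence $P^{R}_{A;h}(z)=\{a_{ij}\,h_j\,z^{j}\}_{i,j=0,1,2,\ldots}$ defines a regular method of summability.
   Context: Let $c$ be the space of all convergent sequences of complex scalars. A double sequence $B=\{b_{ij}\}_{i,j=0,1,2,\ldots}$ of complex constants is said to define a regular method of summability if the formula $T[s_0,s_1,\ldots]=[t_0,t_1,\ldots]$, with $t_i=\sum_{j=0}^{\infty} b_{ij}s_j$ for $i=0,1,2,\ldots$, defines a linear transformation $T$ of $c$ into itself (in particular all the series converge for every $[s_j]\in c$) which preserves limits, i.e. $\lim_{i\to\infty}t_i=\lim_{i\to\infty}s_i$ for every $[s_i]\in c$. The convention $z^0=1$ is used for all $z$, including $z=0$. *)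

theory Defs
  imports Complex_Main "HOL-Computational_Algebra.Formal_Power_Series"
begin

definition conv_seqs :: "(nat \<Rightarrow> complex) set" where
  "conv_seqs = {s. convergent s}"

definition summ_transform ::
  "(nat \<Rightarrow> nat \<Rightarrow> complex) \<Rightarrow> (nat \<Rightarrow> complex) \<Rightarrow> (nat \<Rightarrow> complex)" where
  "summ_transform b s = (\<lambda>i. \<Sum>j. b i j * s j)"

text \<open>
  Since \<^term>\<open>suminf\<close> and \<^term>\<open>lim\<close> are total, convergence of the series (first clause) and
  of the transformed sequence (second clause) must be required explicitly. Linearity on
  \<^term>\<open>conv_seqs\<close> is listed as part of the notion, although it follows from the first clause.
\<close>

definition regular_method :: "(nat \<Rightarrow> nat \<Rightarrow> complex) \<Rightarrow> bool" where
  "regular_method b \<longleftrightarrow>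
     (\<forall>s\<in>conv_seqs. \<forall>i. summable (\<lambda>j. b i j * s j)) \<and>
     (\<forall>s\<in>conv_seqs. summ_transform b s \<in> conv_seqs) \<and>
     (\<forall>s\<in>conv_seqs. \<forall>u\<in>conv_seqs. \<forall>i.
        summ_transform b (\<lambda>j. s j + u j) i = summ_transform b s i + summ_transform b u i) \<and>
     (\<forall>c. \<forall>s\<in>conv_seqs. \<forall>i.
        summ_transform b (\<lambda>j. c * s j) i = c * summ_transform b s i) \<and>
     (\<forall>s\<in>conv_seqs. lim (summ_transform b s) = lim s)"

text \<open>
  The formal power series \<open>h\<close> is not assumed to converge anywhere. The convention
  \<open>z ^ 0 = 1\<close> for all \<open>z\<close>, including \<open>z = 0\<close>, is that of \<^term>\<open>(^)\<close>.
\<close>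

definition power_series_method ::
  "(nat \<Rightarrow> nat \<Rightarrow> complex) \<Rightarrow> complex fps \<Rightarrow> complex \<Rightarrow> (nat \<Rightarrow> nat \<Rightarrow> complex)" where
  "power_series_method a h z = (\<lambda>i j. a i j * fps_nth h j * z ^ j)"

end

theory Submission
  imports Defs
begin

text \<open>
  Write \<open>w j = h j * z ^ j\<close>. Multiplying the \<open>j\<close>-th column of \<open>a\<close> by \<open>w j\<close> has the same effect
  on a sequence \<open>s\<close> as applying \<open>a\<close> to the pointwise product \<open>w * s\<close>, entry by entry and hence
  also for the convergence of the row series. Since \<open>w\<close> converges, say to \<open>L\<close>, the product
  \<open>w * s\<close> is again convergent, with limit \<open>L * lim s\<close>, and regularity of \<open>a\<close> makes
  the scaled method send \<open>s\<close> to a sequence with that limit. So the scaled method multiplies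
  all limits by \<open>L\<close>. If \<open>L = 1\<close> it preserves them; conversely, testing it on the constant
  sequence \<open>1\<close> forces \<open>L = 1\<close>.
\<close>

text \<open>
  Linearity is automatic for convergent series, so regularity reduces to a statement about
  limits, in which \<^const>\<open>lim\<close> and \<^const>\<open>suminf\<close> are only used where they are meaningful.
\<close>

lemma regular_method_iff_tendsto:
  "regular_method b \<longleftrightarrow>
     (\<forall>s L. s \<longlonglongrightarrow> L \<longrightarrow>
        (\<forall>i. summable (\<lambda>j. b i j * s j)) \<and> summ_transform b s \<longlonglongrightarrow> L)"
  (is "_ \<longleftrightarrow> ?lims")
proof
  assume "regular_method b"
  then show ?lims
    unfolding regular_method_def conv_seqs_def
    by (metis convergentI convergent_LIMSEQ_iff limI mem_Collect_eq)
next
  assume lims: ?lims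
  have summable: "summable (\<lambda>j. b i j * s j)" if "convergent s" for s i
    using lims that by (auto simp: convergent_def)
  have tendsto: "summ_transform b s \<longlonglongrightarrow> lim s" if "convergent s" for s
    using lims that by (auto simp: convergent_LIMSEQ_iff)
  have add: "summ_transform b (\<lambda>j. s j + u j) i = summ_transform b s i + summ_transform b u i"
    if "convergent s" "convergent u" for s u i
    using suminf_add[OF summable summable, OF that]
    by (simp add: summ_transform_def distrib_left)
  have scale: "summ_transform b (\<lambda>j. c * s j) i = c * summ_transform b s i"
    if "convergent s" for c s i
    using suminf_mult[OF summable, OF that]
    by (simp add: summ_transform_def mult.left_commute)
  show "regular_method b"
    unfolding regular_method_def conv_seqs_def
    using summable tendsto add scale by (auto intro: convergentI limI)
qed

lemma summ_transform_scale_columns: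
  "summ_transform (\<lambda>i j. b i j * w j) s = summ_transform b (\<lambda>j. w j * s j)"
  by (simp add: summ_transform_def mult.assoc)

text \<open>
  Scaling the columns by \<open>w\<close> multiplies all limits by \<open>L\<close>; the constant sequence \<open>1\<close> detects
  this factor.
\<close>

lemma regular_method_scale_columns_iff:
  assumes reg: "regular_method b" and w: "w \<longlonglongrightarrow> L"
  shows "regular_method (\<lambda>i j. b i j * w j) \<longleftrightarrow> L = 1"
proof -
  have row: "summable (\<lambda>j. b i j * w j * s j)"
    and lim: "summ_transform (\<lambda>i j. b i j * w j) s \<longlonglongrightarrow> L * M"
    if "s \<longlonglongrightarrow> M" for s M i
    using reg tendsto_mult[OF w that]
    by (auto simp: regular_method_iff_tendsto summ_transform_scale_columns mult.assoc)
  show ?thesis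
  proof
    assume "regular_method (\<lambda>i j. b i j * w j)"
    then have "summ_transform (\<lambda>i j. b i j * w j) (\<lambda>_. 1) \<longlonglongrightarrow> 1"
      by (simp add: regular_method_iff_tendsto)
    with lim[of "\<lambda>_. 1" 1] show "L = 1"
      using LIMSEQ_unique by fastforce
  next
    assume "L = 1"
    with row lim show "regular_method (\<lambda>i j. b i j * w j)"
      unfolding regular_method_iff_tendsto by simp
  qed
qed

theorem proposition1:
  fixes a :: "nat \<Rightarrow> nat \<Rightarrow> complex" and h :: "complex fps" and z :: complex
  assumes "regular_method a"
    and "convergent (\<lambda>i. fps_nth h i * z ^ i)"
  shows "(\<lambda>j. fps_nth h j * z ^ j) \<longlonglongrightarrow> 1 \<longleftrightarrow>
         regular_method (power_series_method a h z)"
proof -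
  obtain L where L: "(\<lambda>j. fps_nth h j * z ^ j) \<longlonglongrightarrow> L"
    using assms(2) by (auto simp: convergent_def)
  have "power_series_method a h z = (\<lambda>i j. a i j * (fps_nth h j * z ^ j))"
    by (simp add: power_series_method_def mult.assoc)
  then have "regular_method (power_series_method a h z) \<longleftrightarrow> L = 1"
    using regular_method_scale_columns_iff[OF assms(1) L] by simp
  also have "\<dots> \<longleftrightarrow> (\<lambda>j. fps_nth h j * z ^ j) \<longlonglongrightarrow> 1"
    using L LIMSEQ_unique by blast
  finally show ?thesis by simp
qed

end
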